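(* If the task inference module $\bar f$ and the discrete encoder $\bar T$ are sought in a family with infinite capacity (e.g., the family of all measurable functions), then the optimization problem $$\text{(B)}\qquad \min_{\mathcal{E},\pi,\bar f}\ \min_{\gamma\in\Gamma}\ \min_{\bar T:\ \bar T_{\#}\mathbb{P}_x=\gamma}\ \mathbb{E}_{(x,y)\sim\mathbb{P}_{(x,y)}}\Big[L_{\mathrm{task}}\big(\bar f(\bar T(x));x,y\big)\Big]$$ is equivalent to the optimization problem $$\text{(C)}\qquad \min_{\mathcal{E},\pi,\gamma\in\Gamma}\ \min_{\bar f,T}\ \Big\{\mathbb{E}_{(x,y)\sim\mathbb{P}_{(x,y)}}\Big[L_{\mathrm{task}}\big(\bar f(\mathrm{VQ}_{\mathcal{E}}(T(x)));x,y\big)\Big]+\lambda\,\mathcal{W}_{d_z}\big(T_{\#}\mathbb{P}_x,\gamma\big)\Big\},$$ where $\mathrm{VQ}_{\mathcal{E}}$ is the quantization operator returning the codeword sequence closest to the encoder output $T(x)$, and $\lambda>0$ is a trade-off factor.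
   Context: Data: $x_1,\dots,x_N\in\mathbb{R}^n$, with empirical distribution $\mathbb{P}_x=\frac1N\sum_{i=1}^N\delta_{x_i}$; $y$ denotes the target label of $x$, and $\mathbb{P}_{(x,y)}$ is the distribution of data-label pairs. $L_{\mathrm{task}}(\,\cdot\,;x,y)$ is a (general) task loss, evaluated on the output of the task inference module for the sample $x$ with label $y$. A codebook is a set of codewords $\mathcal{E}=\{\mathbf{e}_k\in\mathbb{R}^D: k=1,\dots,K\}$, and $\mathcal{E}^Q\subset\mathbb{R}^{Q\times D}$ is the set of length-$Q$ sequences of codewords. The weights are $\pi=[\pi^1,\dots,\pi^Q]$ with each $\pi^q$ in the simplex $\Delta_{K-1}=\{\alpha\ge 0:\ \|\alpha\|_1=1\}$, and $\mathbb{P}_{\mathcal{E},\pi^q}=\sum_{k=1}^K\pi_k^q\delta_{\mathbf{e}_k}$, $q=1,\dots,Q$. $\Gamma=\Gamma(\mathbb{P}_{\mathcal{E},\pi^1},\dots,\mathbb{P}_{\mathcal{E},\pi^Q})$ is the set of all joint distributions $\gamma$ on $\mathcal{E}^Q$ having $\mathbb{P}_{\mathcal{E},\pi^1},\dots,\mathbb{P}_{\mathcal{E},\pi^Q}$ as marginals. Codebook $\mathcal{E}$ and weights $\pi$ are variables of both problems. In (B), $\bar T$ is a deterministic discrete encoder, mapping a data sample $x$ directly to a sequence of $Q$ codewords in $\mathcal{E}^Q$. In (C), $T$ is a continuous encoder, mapping $x$ to a continuous latent representation $T(x)=[T^q(x)]_{q=1}^Q\in\mathbb{R}^{Q\times D}$.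 $\bar f$ is a generalized task inference module acting on codeword sequences (for classification, for example, it includes a classifier). $\mathrm{VQ}_{\mathcal{E}}$ acts componentwise by nearest-neighbour search: the $q$-th component of $\mathrm{VQ}_{\mathcal{E}}(z)$ is $\arg\min_{\mathbf{e}_k\in\mathcal{E}}\|z^q-\mathbf{e}_k\|_2$. For a latent $z=[z^q]_{q=1}^Q$ and a codeword sequence $c=[c^q]_{q=1}^Q\in\mathcal{E}^Q$, $d_z(z,c)=\frac1Q\sum_{q=1}^Q\rho_z(z^q,c^q)$, where $\rho_z$ is a distance on the $q$-th components. $\bar T_{\#}\mathbb{P}_x$ and $T_{\#}\mathbb{P}_x$ denote push-forwards. For a cost $d$, $\mathcal{W}_d(\mu,\nu)$ is the Wasserstein distance, the infimum of $\mathbb{E}_{(u,v)\sim\omega}[d(u,v)]$ over all joint distributions $\omega$ with marginals $\mu$ and $\nu$. *)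

theory Defs
  imports "HOL-Probability.Probability"
begin

text \<open>
  A codebook is a family of \<open>K = CARD('k)\<close> codewords in \<open>D = CARD('d)\<close> dimensions (repetitions are
  not excluded), and latents and codeword sequences are \<open>Q \<times> D\<close> arrays with \<open>Q = CARD('q)\<close>.
  Every distribution entering a push-forward, a marginal constraint or a coupling is discrete,
  so distributions are probability mass functions and push-forward is \<^const>\<open>map_pmf\<close>.
\<close>

type_synonym ('d, 'k) codebook = "real^'d^'k"
type_synonym ('d, 'q) latent = "real^'d^'q"
type_synonym ('k, 'q) weights = "real^'k^'q"

definition codewords :: "('d::finite, 'k::finite) codebook \<Rightarrow> (real^'d) set" where
  "codewords E = range (\<lambda>k. E $ k)"

definition codeword_seqs :: "('d::finite, 'k::finite) codebook \<Rightarrow> ('d, 'q::finite) latent set" where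
  "codeword_seqs E = {c. \<forall>q. c $ q \<in> codewords E}"

definition prob_simplex :: "(real^'k::finite) set" where
  "prob_simplex = {\<alpha>. (\<forall>k. 0 \<le> \<alpha> $ k) \<and> (\<Sum>k\<in>UNIV. \<bar>\<alpha> $ k\<bar>) = 1}"

text \<open>
  \<open>\<Sum>\<^sub>k \<alpha>\<^sub>k \<delta>(e\<^sub>k)\<close>; meaningful for weights in the simplex only, see \<open>pmf_codeword_pmf\<close> below.
\<close>

definition codeword_pmf :: "('d::finite, 'k::finite) codebook \<Rightarrow> real^'k \<Rightarrow> (real^'d) pmf" where
  "codeword_pmf E \<alpha> = map_pmf (\<lambda>k. E $ k) (embed_pmf (\<lambda>k. \<alpha> $ k))"

definition joint_dists ::
  "('d::finite, 'k::finite) codebook \<Rightarrow> ('k, 'q::finite) weights \<Rightarrow> ('d, 'q) latent pmf set" where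
  "joint_dists E \<pi> = {\<gamma>. set_pmf \<gamma> \<subseteq> codeword_seqs E \<and>
     (\<forall>q. map_pmf (\<lambda>c. c $ q) \<gamma> = codeword_pmf E (\<pi> $ q))}"

definition empirical :: "nat \<Rightarrow> (nat \<Rightarrow> 'a) \<Rightarrow> 'a pmf" where
  "empirical N x = map_pmf x (pmf_of_set {..<N})"

text \<open>Ties in the nearest-neighbour search are broken by the choice operator.\<close>

definition VQ :: "('d::finite, 'k::finite) codebook \<Rightarrow> ('d, 'q::finite) latent \<Rightarrow> ('d, 'q) latent" where
  "VQ E z = (\<chi> q. arg_min_on (\<lambda>c. norm (z $ q - c)) (codewords E))"

definition latent_dist ::
  "(real^'d \<Rightarrow> real^'d \<Rightarrow> real) \<Rightarrow> ('d::finite, 'q::finite) latent \<Rightarrow> ('d, 'q) latent \<Rightarrow> real" where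
  "latent_dist \<rho> z c = (\<Sum>q\<in>UNIV. \<rho> (z $ q) (c $ q)) / real CARD('q)"

definition couplings :: "'a pmf \<Rightarrow> 'b pmf \<Rightarrow> ('a \<times> 'b) pmf set" where
  "couplings \<mu> \<nu> = {\<omega>. map_pmf fst \<omega> = \<mu> \<and> map_pmf snd \<omega> = \<nu>}"

text \<open>
  The real-valued infimum and expectations are proper for nonnegative costs and finitely supported
  arguments; the distributions below are finitely supported.
\<close>

definition wasserstein :: "('a \<Rightarrow> 'b \<Rightarrow> real) \<Rightarrow> 'a pmf \<Rightarrow> 'b pmf \<Rightarrow> real" where
  "wasserstein d \<mu> \<nu> =
     (INF \<omega>\<in>couplings \<mu> \<nu>. measure_pmf.expectation \<omega> (\<lambda>(u, v). d u v))"

text \<open>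
  A family has infinite capacity with respect to the value set \<open>Y\<close> if its \<open>Y\<close>-valued members
  realise every assignment of values in \<open>Y\<close> to finitely many inputs. The family of all measurable
  functions has this property for every nonempty \<open>Y\<close>, see \<open>infinite_capacity_measurable\<close>.
\<close>

definition infinite_capacity :: "'b set \<Rightarrow> ('a \<Rightarrow> 'b) set \<Rightarrow> bool" where
  "infinite_capacity Y H \<longleftrightarrow>
     (\<forall>S g. finite S \<and> g ` S \<subseteq> Y \<longrightarrow> (\<exists>h\<in>H. range h \<subseteq> Y \<and> (\<forall>s\<in>S. h s = g s)))"

text \<open>
  The remaining definitions describe the two optimization problems. A point is a tuple
  \<open>(E, \<pi>, \<gamma>, f, T)\<close> of all the variables, so an iterated minimum is one minimum over a feasible
  set. \<open>P\<close> is the distribution of data-label pairs and \<open>Px\<close> that of the data. Feasibility includes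
  that the expected task loss exists, which is automatic when \<open>P\<close> has finite support.
\<close>

definition expected_loss ::
  "('a \<times> 'y) pmf \<Rightarrow> ('o \<Rightarrow> 'a \<Rightarrow> 'y \<Rightarrow> real) \<Rightarrow> ('a \<Rightarrow> 'o) \<Rightarrow> real" where
  "expected_loss P L g = measure_pmf.expectation P (\<lambda>(x, y). L (g x) x y)"

definition loss_integrable ::
  "('a \<times> 'y) pmf \<Rightarrow> ('o \<Rightarrow> 'a \<Rightarrow> 'y \<Rightarrow> real) \<Rightarrow> ('a \<Rightarrow> 'o) \<Rightarrow> bool" where
  "loss_integrable P L g \<longleftrightarrow> integrable (measure_pmf P) (\<lambda>(x, y). L (g x) x y)"

type_synonym ('n, 'd, 'k, 'q, 'o) point =
  "('d, 'k) codebook \<times> ('k, 'q) weights \<times> ('d, 'q) latent pmf \<times>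
   (('d, 'q) latent \<Rightarrow> 'o) \<times> (real^'n \<Rightarrow> ('d, 'q) latent)"

definition feasible_B ::
  "((real^'n::finite) \<times> 'y) pmf \<Rightarrow> (real^'n) pmf \<Rightarrow> ('o \<Rightarrow> real^'n \<Rightarrow> 'y \<Rightarrow> real) \<Rightarrow>
   (('d::finite, 'q::finite) latent \<Rightarrow> 'o) set \<Rightarrow> (real^'n \<Rightarrow> ('d, 'q) latent) set \<Rightarrow>
   ('n, 'd, 'k::finite, 'q, 'o) point set" where
  "feasible_B P Px L F H = {(E, \<pi>, \<gamma>, f, T).
     (\<forall>q. \<pi> $ q \<in> prob_simplex) \<and> \<gamma> \<in> joint_dists E \<pi> \<and> f \<in> F \<and>
     T \<in> H \<and> range T \<subseteq> codeword_seqs E \<and> map_pmf T Px = \<gamma> \<and>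
     loss_integrable P L (\<lambda>x. f (T x))}"

fun objective_B ::
  "((real^'n::finite) \<times> 'y) pmf \<Rightarrow> ('o \<Rightarrow> real^'n \<Rightarrow> 'y \<Rightarrow> real) \<Rightarrow>
   ('n, 'd::finite, 'k::finite, 'q::finite, 'o) point \<Rightarrow> real" where
  "objective_B P L (E, \<pi>, \<gamma>, f, T) = expected_loss P L (\<lambda>x. f (T x))"

definition feasible_C ::
  "((real^'n::finite) \<times> 'y) pmf \<Rightarrow> ('o \<Rightarrow> real^'n \<Rightarrow> 'y \<Rightarrow> real) \<Rightarrow>
   (('d::finite, 'q::finite) latent \<Rightarrow> 'o) set \<Rightarrow> (real^'n \<Rightarrow> ('d, 'q) latent) set \<Rightarrow>
   ('n, 'd, 'k::finite, 'q, 'o) point set" where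
  "feasible_C P L F G = {(E, \<pi>, \<gamma>, f, T).
     (\<forall>q. \<pi> $ q \<in> prob_simplex) \<and> \<gamma> \<in> joint_dists E \<pi> \<and> f \<in> F \<and> T \<in> G \<and>
     loss_integrable P L (\<lambda>x. f (VQ E (T x)))}"

fun objective_C ::
  "((real^'n::finite) \<times> 'y) pmf \<Rightarrow> (real^'n) pmf \<Rightarrow> ('o \<Rightarrow> real^'n \<Rightarrow> 'y \<Rightarrow> real) \<Rightarrow>
   (real^'d \<Rightarrow> real^'d \<Rightarrow> real) \<Rightarrow> real \<Rightarrow>
   ('n, 'd::finite, 'k::finite, 'q::finite, 'o) point \<Rightarrow> real" where
  "objective_C P Px L \<rho> lam (E, \<pi>, \<gamma>, f, T) =
     expected_loss P L (\<lambda>x. f (VQ E (T x))) + lam * wasserstein (latent_dist \<rho>) (map_pmf T Px) \<gamma>"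

text \<open>
  The infimum of an objective is taken in the extended reals, since the loss need not be bounded
  below.
\<close>

definition optimal_value :: "('p \<Rightarrow> real) \<Rightarrow> 'p set \<Rightarrow> ereal" where
  "optimal_value obj A = (INF p\<in>A. ereal (obj p))"

definition minimizer :: "('p \<Rightarrow> real) \<Rightarrow> 'p set \<Rightarrow> 'p \<Rightarrow> bool" where
  "minimizer obj A p \<longleftrightarrow> is_arg_min obj (\<lambda>p. p \<in> A) p"

lemma pmf_codeword_pmf:
  assumes "\<alpha> \<in> prob_simplex"
  shows "pmf (codeword_pmf E \<alpha>) c = (\<Sum>k | E $ k = c. \<alpha> $ k)"
proof -
  have nonneg: "\<And>k. 0 \<le> \<alpha> $ k" and one: "(\<Sum>k\<in>UNIV. \<alpha> $ k) = 1"
    using assms by (auto simp: prob_simplex_def)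
  have "(\<integral>\<^sup>+ k. ennreal (\<alpha> $ k) \<partial>count_space UNIV) = 1"
    using one nonneg by (simp add: nn_integral_count_space_finite sum_ennreal)
  then have "pmf (embed_pmf (\<lambda>k. \<alpha> $ k)) k = \<alpha> $ k" for k
    using nonneg by (simp add: pmf_embed_pmf)
  then show ?thesis
    by (simp add: codeword_pmf_def pmf_map measure_measure_pmf_finite vimage_def)
qed

lemma infinite_capacity_measurable:
  fixes Y :: "'b::topological_space set"
  assumes "Y \<noteq> {}"
  shows "infinite_capacity Y (borel_measurable borel :: ('a::t1_space \<Rightarrow> 'b) set)"
  unfolding infinite_capacity_def
proof (intro allI impI)
  fix S :: "'a set" and g :: "'a \<Rightarrow> 'b"
  assume S: "finite S \<and> g ` S \<subseteq> Y"
  obtain y where y: "y \<in> Y" using assms by blast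
  have "finite S" "g ` S \<subseteq> Y" using S by auto
  then show "\<exists>h\<in>borel_measurable borel. range h \<subseteq> Y \<and> (\<forall>s\<in>S. h s = g s)"
  proof (induction S rule: finite_induct)
    case empty
    show ?case using y by (intro bexI[of _ "\<lambda>_. y"]) auto
  next
    case (insert s S)
    then obtain h where h: "h \<in> borel_measurable borel" "range h \<subseteq> Y" "\<forall>t\<in>S. h t = g t"
      by auto
    have "(\<lambda>t. if t = s then g s else h t) \<in> borel_measurable borel"
      by (intro measurable_If h) auto
    moreover have "range (\<lambda>t. if t = s then g s else h t) \<subseteq> Y"
      using h insert.prems by auto
    ultimately show ?case
      using h by (intro bexI[of _ "\<lambda>t. if t = s then g s else h t"]) auto
  qed
qed

end

theory Submission
  imports Defs
begin

text \<open>
  On the finitely many data points a discrete encoder is interpolated by a continuous one. It is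
  fixed by quantization and its push-forward is \<open>\<gamma>\<close>, so the Wasserstein term vanishes.
  Conversely, \<open>VQ \<circ> T\<close> is a discrete encoder with the same task loss once \<open>\<gamma>\<close> and \<open>\<pi>\<close> are
  replaced by its push-forward and the marginals of that. So the optimal values agree, and at a
  minimizer of (C) the Wasserstein term is zero. For a distance and finitely supported
  distributions this forces \<open>T\<close> to push the data to \<open>\<gamma>\<close>, so \<open>T\<close> already takes
  codeword sequences as values on the data.
\<close>

lemma minimizer_iff: "minimizer obj A p \<longleftrightarrow> p \<in> A \<and> (\<forall>r\<in>A. obj p \<le> obj r)"
  unfolding minimizer_def is_arg_min_linorder by auto

section \<open>Couplings and the Wasserstein distance of discrete distributions\<close>

lemma couplings_nonempty: "couplings \<mu> \<nu> \<noteq> {}"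
proof -
  \<comment> \<open>The independent coupling. Nonemptiness is what lets a bound valid for every
    coupling pass to the real infimum.\<close>
  have "pair_pmf \<mu> \<nu> \<in> couplings \<mu> \<nu>"
    by (simp add: couplings_def map_fst_pair_pmf map_snd_pair_pmf)
  then show ?thesis by blast
qed

lemma expectation_nonneg:
  fixes d :: "'a \<Rightarrow> 'b \<Rightarrow> real"
  assumes "\<And>u v. 0 \<le> d u v"
  shows "0 \<le> measure_pmf.expectation \<omega> (\<lambda>(u, v). d u v)"
  using assms by (intro integral_nonneg_AE) auto

lemma wasserstein_nonneg:
  assumes "\<And>u v. 0 \<le> d u v"
  shows "0 \<le> wasserstein d \<mu> \<nu>"
  unfolding wasserstein_def
  by (intro cINF_greatest couplings_nonempty expectation_nonneg assms)

lemma wasserstein_self: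
  assumes "\<And>u v. 0 \<le> d u v" and "\<And>u. d u u = 0"
  shows "wasserstein d \<mu> \<mu> = 0"
proof (rule antisym)
  \<comment> \<open>The diagonal coupling moves no mass, so its cost is 0.\<close>
  let ?\<omega> = "map_pmf (\<lambda>u. (u, u)) \<mu>"
  have "?\<omega> \<in> couplings \<mu> \<mu>"
    by (simp add: couplings_def pmf.map_comp o_def)
  moreover have "measure_pmf.expectation ?\<omega> (\<lambda>(u, v). d u v) = 0"
    by (simp add: assms)
  moreover have "bdd_below ((\<lambda>\<omega>. measure_pmf.expectation \<omega> (\<lambda>(u, v). d u v)) ` couplings \<mu> \<mu>)"
    using expectation_nonneg[OF assms(1)] by (intro bdd_belowI[of _ 0]) auto
  ultimately show "wasserstein d \<mu> \<mu> \<le> 0"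
    unfolding wasserstein_def by (intro cINF_lower2[of _ _ ?\<omega>]) auto
qed (rule wasserstein_nonneg[OF assms(1)])

text \<open>The two masses at \<open>a\<close> are the probabilities under \<omega> of the events
  that the first, respectively the second, component is \<open>a\<close>. These events differ only
  off the diagonal.\<close>

lemma coupling_pmf_diff_le:
  assumes "\<omega> \<in> couplings \<mu> \<nu>"
  shows "\<bar>pmf \<mu> a - pmf \<nu> a\<bar> \<le> measure_pmf.prob \<omega> {(u, v). u \<noteq> v}"
proof -
  let ?M = "measure_pmf.prob \<omega>"
  have \<mu>: "pmf \<mu> a = ?M {p. fst p = a}" and \<nu>: "pmf \<nu> a = ?M {p. snd p = a}"
    using assms by (auto simp: couplings_def pmf_map vimage_def)
  have "?M {p. fst p = a} \<le> ?M ({p. snd p = a} \<union> {(u, v). u \<noteq> v})"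
    by (intro measure_pmf.finite_measure_mono) auto
  moreover have "?M {p. snd p = a} \<le> ?M ({p. fst p = a} \<union> {(u, v). u \<noteq> v})"
    by (intro measure_pmf.finite_measure_mono) auto
  moreover have "?M (X \<union> Y) \<le> ?M X + ?M Y" for X Y
    by (intro measure_Un_le) auto
  ultimately show ?thesis
    unfolding \<mu> \<nu> abs_le_iff by (smt (verit))
qed

text \<open>No optimal coupling is extracted. With finite supports, distinct support points are at
  least some \<delta> > 0 apart, so every coupling costs at least \<delta> times its off-diagonal
  mass. By \<open>coupling_pmf_diff_le\<close> this gives a bound independent of the coupling, which
  therefore survives the infimum.\<close>

lemma wasserstein_eq_0D:
  assumes nonneg: "\<And>u v. 0 \<le> d u v" and sep: "\<And>u v. d u v = 0 \<Longrightarrow> u = v"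
    and fin: "finite (set_pmf \<mu>)" "finite (set_pmf \<nu>)"
    and zero: "wasserstein d \<mu> \<nu> = 0"
  shows "\<mu> = \<nu>"
proof (rule pmf_eqI)
  fix a
  \<comment> \<open>The extra element 1 keeps \<open>Min D\<close> meaningful and positive when
    there are no distinct pairs.\<close>
  define D where "D = insert 1 ((\<lambda>(u, v). d u v) ` {(u, v) \<in> set_pmf \<mu> \<times> set_pmf \<nu>. u \<noteq> v})"
  define \<delta> where "\<delta> = Min D"
  have finD: "finite D"
    unfolding D_def using fin
    by (auto intro!: finite_imageI intro: finite_subset[of _ "set_pmf \<mu> \<times> set_pmf \<nu>"])
  have "\<forall>r\<in>D. 0 < r"
    unfolding D_def using nonneg sep by (auto simp: less_le)
  then have \<delta>: "0 < \<delta>"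
    unfolding \<delta>_def using finD by (simp add: D_def)
  have "\<delta> * \<bar>pmf \<mu> a - pmf \<nu> a\<bar> \<le> measure_pmf.expectation \<omega> (\<lambda>(u, v). d u v)"
    if \<omega>: "\<omega> \<in> couplings \<mu> \<nu>" for \<omega>
  proof -
    let ?N = "{(u, v). u \<noteq> v}"
    have sub: "set_pmf \<omega> \<subseteq> set_pmf \<mu> \<times> set_pmf \<nu>"
      using \<omega> by (force simp: couplings_def)
    then have fin\<omega>: "finite (set_pmf \<omega>)"
      using fin by (meson finite_SigmaI finite_subset)
    have "\<delta> * \<bar>pmf \<mu> a - pmf \<nu> a\<bar> \<le> \<delta> * measure_pmf.prob \<omega> ?N"
      using coupling_pmf_diff_le[OF \<omega>] \<delta> by simp
    also have "\<dots> = measure_pmf.expectation \<omega> (\<lambda>p. \<delta> * indicator ?N p)"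
      by simp
    also have "\<dots> \<le> measure_pmf.expectation \<omega> (\<lambda>(u, v). d u v)"
    \<comment> \<open>Finite support makes the cost integrable, so its expectation is not the
      default value 0 of a divergent integral.\<close>
    proof (intro integral_mono_AE integrable_measure_pmf_finite fin\<omega> AE_pmfI)
      fix p assume p: "p \<in> set_pmf \<omega>"
      obtain u v where uv: "p = (u, v)" by fastforce
      have "\<delta> \<le> d u v" if "u \<noteq> v"
        unfolding \<delta>_def using p sub uv that
        by (intro Min_le[OF finD]) (auto simp: D_def)
      then show "\<delta> * indicator ?N p \<le> (case p of (u, v) \<Rightarrow> d u v)"
        using nonneg uv by (auto simp: indicator_def)
    qed
    finally show ?thesis .
  qed
  then have "\<delta> * \<bar>pmf \<mu> a - pmf \<nu> a\<bar> \<le> wasserstein d \<mu> \<nu>"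
    unfolding wasserstein_def by (intro cINF_greatest couplings_nonempty)
  then show "pmf \<mu> a = pmf \<nu> a"
    using \<delta> zero by (simp add: mult_le_0_iff)
qed

section \<open>The latent distance, quantization and codeword weights\<close>

lemma latent_dist_nonneg:
  assumes "Metric_space UNIV \<rho>"
  shows "0 \<le> latent_dist \<rho> z c"
proof -
  interpret Metric_space UNIV \<rho> by fact
  show ?thesis by (simp add: latent_dist_def sum_nonneg)
qed

lemma latent_dist_eq_0_iff:
  assumes "Metric_space UNIV \<rho>"
  shows "latent_dist \<rho> z c = 0 \<longleftrightarrow> z = c"
proof -
  interpret Metric_space UNIV \<rho> by fact
  show ?thesis
    by (simp add: latent_dist_def sum_nonneg_eq_0_iff vec_eq_iff)
qed

lemma finite_codeword_seqs:
  "finite (codeword_seqs E :: ('d::finite, 'q::finite) latent set)"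
proof (rule finite_subset)
  show "codeword_seqs E \<subseteq> range (\<lambda>g :: 'q \<Rightarrow> _. \<chi> q. E $ g q)"
  proof
    fix c :: "('d, 'q) latent" assume "c \<in> codeword_seqs E"
    then have "\<forall>q. \<exists>k. c $ q = E $ k"
      by (auto simp: codeword_seqs_def codewords_def)
    then obtain g where "\<forall>q. c $ q = E $ g q" by metis
    then have "c = (\<chi> q. E $ g q)" by (simp add: vec_eq_iff)
    then show "c \<in> range (\<lambda>g :: 'q \<Rightarrow> _. \<chi> q. E $ g q)" by blast
  qed
qed simp

lemma VQ_in_codeword_seqs: "VQ E z \<in> codeword_seqs E"
  unfolding VQ_def codeword_seqs_def
  by (auto intro!: arg_min_if_finite(1) simp: codewords_def)

text \<open>A codeword is at distance 0 from itself, so any nearest codeword is at distance 0 and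
  hence equal to it. The tie-breaking rule has no influence here.\<close>

lemma VQ_codeword_seq:
  assumes "c \<in> codeword_seqs E"
  shows "VQ E c = c"
proof -
  have "arg_min_on (\<lambda>e. norm (c $ q - e)) (codewords E) = c $ q" for q
  proof -
    have cq: "c $ q \<in> codewords E"
      using assms by (simp add: codeword_seqs_def)
    have "norm (c $ q - arg_min_on (\<lambda>e. norm (c $ q - e)) (codewords E)) \<le> norm (c $ q - c $ q)"
      by (rule arg_min_least) (use cq in \<open>auto simp: codewords_def\<close>)
    then show ?thesis by simp
  qed
  then show ?thesis by (simp add: VQ_def vec_eq_iff)
qed

text \<open>
  The index chosen for a codeword makes the weights well defined even if the codebook has
  repetitions.
\<close>

lemma ex_weights_codeword_pmf:
  assumes "set_pmf p \<subseteq> codewords E"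
  shows "\<exists>\<alpha>\<in>prob_simplex. codeword_pmf E \<alpha> = p"
proof -
  define idx where "idx c = (SOME k. E $ k = c)" for c
  have idx: "E $ idx c = c" if "c \<in> codewords E" for c
    using that unfolding idx_def codewords_def by (auto intro: someI_ex)
  define \<alpha> where "\<alpha> = (\<chi> k. pmf (map_pmf idx p) k)"
  have "\<alpha> \<in> prob_simplex"
    by (simp add: \<alpha>_def prob_simplex_def sum_pmf_eq_1)
  \<comment> \<open>\<open>embed_pmf\<close> inverts \<open>pmf\<close>, so these weights give back
    the distribution of the chosen indices.\<close>
  moreover have "codeword_pmf E \<alpha> = map_pmf (\<lambda>c. E $ idx c) p"
    by (simp add: \<alpha>_def codeword_pmf_def type_definition.Rep_inverse[OF td_pmf_embed_pmf] pmf.map_comp o_def)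
  moreover have "map_pmf (\<lambda>c. E $ idx c) p = p"
    using assms idx by (intro map_pmf_idI) auto
  ultimately show ?thesis by auto
qed

text \<open>Since \<pi> is a variable, the marginal constraints can always be met by reading the
  weights off the marginals of \<gamma>. This makes the push-forward of any discrete encoder
  admissible.\<close>

lemma ex_weights_joint_dists:
  fixes \<gamma> :: "('d::finite, 'q::finite) latent pmf" and E :: "('d, 'k::finite) codebook"
  assumes "set_pmf \<gamma> \<subseteq> codeword_seqs E"
  shows "\<exists>\<pi>. (\<forall>q. \<pi> $ q \<in> prob_simplex) \<and> \<gamma> \<in> joint_dists E \<pi>"
proof -
  have "\<forall>q. \<exists>\<alpha>. \<alpha> \<in> prob_simplex \<and> codeword_pmf E \<alpha> = map_pmf (\<lambda>c. c $ q) \<gamma>"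
    using ex_weights_codeword_pmf[of "map_pmf (\<lambda>c. c $ _) \<gamma>" E] assms
    by (force simp: codeword_seqs_def)
  then obtain w where "\<forall>q. w q \<in> prob_simplex \<and> codeword_pmf E (w q) = map_pmf (\<lambda>c. c $ q) \<gamma>"
    by metis
  then show ?thesis
    using assms by (intro exI[of _ "\<chi> q. w q"]) (simp add: joint_dists_def)
qed

section \<open>Transfer of feasible points between the two problems\<close>

lemma continuous_interpolation:
  fixes g :: "'a::euclidean_space \<Rightarrow> 'b::real_inner"
  assumes "finite S"
  shows "\<exists>h. continuous_on UNIV h \<and> (\<forall>s\<in>S. h s = g s)"
proof -
  obtain h where "continuous_on UNIV h" "\<And>s. s \<in> S \<Longrightarrow> h s = g s"
    \<comment> \<open>A finite set is closed and every function is continuous on it, so Dugundji's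
      extension theorem applies to an arbitrary \<open>g\<close>.\<close>
    by (rule Dugundji[of UNIV UNIV S g])
      (use assms in \<open>auto simp: finite_imp_closed continuous_on_finite\<close>)
  then show ?thesis by blast
qed

lemma expected_loss_cong:
  assumes "\<And>a. a \<in> set_pmf (map_pmf fst P) \<Longrightarrow> g a = h a"
  shows "expected_loss P L g = expected_loss P L h"
  unfolding expected_loss_def
  using assms by (intro integral_cong_AE AE_pmfI) force+

lemma loss_integrable_cong:
  assumes "\<And>a. a \<in> set_pmf (map_pmf fst P) \<Longrightarrow> g a = h a"
  shows "loss_integrable P L g \<longleftrightarrow> loss_integrable P L h"
  unfolding loss_integrable_def
  using assms by (intro integrable_cong_AE AE_pmfI) force+

text \<open>Only the encoder changes, and only off the data, since \<open>T\<close> itself need not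
  lie in \<open>G\<close>. Keeping the other variables is what carries minimizers over, not just
  values.\<close>

lemma feasible_B_imp_feasible_C:
  assumes P: "map_pmf fst P = Px" and fin: "finite (set_pmf Px)"
    and rho: "Metric_space UNIV \<rho>" and G: "{T. continuous_on UNIV T} \<subseteq> G"
    and B: "(E, \<pi>, \<gamma>, f, T) \<in> feasible_B P Px L F H"
  shows "\<exists>T'. (\<forall>a\<in>set_pmf Px. T' a = T a) \<and> (E, \<pi>, \<gamma>, f, T') \<in> feasible_C P L F G \<and>
    objective_C P Px L \<rho> lam (E, \<pi>, \<gamma>, f, T') = objective_B P L (E, \<pi>, \<gamma>, f, T)"
proof -
  obtain T' where cont: "continuous_on UNIV T'" and T': "\<And>a. a \<in> set_pmf Px \<Longrightarrow> T' a = T a"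
    using continuous_interpolation[OF fin, of T] by blast
  have eq: "f (VQ E (T' a)) = f (T a)" if "a \<in> set_pmf (map_pmf fst P)" for a
    using that B T' P by (auto simp: feasible_B_def intro!: arg_cong[of _ _ f] VQ_codeword_seq)
  have "map_pmf T' Px = map_pmf T Px"
    using T' by (intro map_pmf_cong) auto
  also have "\<dots> = \<gamma>"
    using B by (simp add: feasible_B_def)
  finally have "wasserstein (latent_dist \<rho>) (map_pmf T' Px) \<gamma> = 0"
    by (simp add: wasserstein_self latent_dist_nonneg[OF rho] latent_dist_eq_0_iff[OF rho])
  moreover have "expected_loss P L (\<lambda>a. f (VQ E (T' a))) = expected_loss P L (\<lambda>a. f (T a))"
    by (rule expected_loss_cong) (rule eq)
  moreover have "loss_integrable P L (\<lambda>a. f (VQ E (T' a))) = loss_integrable P L (\<lambda>a. f (T a))"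
    by (rule loss_integrable_cong) (rule eq)
  ultimately show ?thesis
    using B G cont T' by (intro exI[of _ T']) (auto simp: feasible_B_def feasible_C_def)
qed

text \<open>Encoders of (B) must lie in \<open>H\<close> and take codeword sequences as values
  everywhere, whereas \<open>g\<close> is controlled only on the data. The lemma serves both for the
  quantized encoder and, at a minimizer of (C), for \<open>T\<close> itself.\<close>

lemma ex_encoder_agreeing:
  fixes E :: "('d::finite, 'k::finite) codebook"
    and H :: "(real^'n::finite \<Rightarrow> ('d, 'q::finite) latent) set"
  assumes P: "map_pmf fst P = Px" and fin: "finite (set_pmf Px)"
    and H: "infinite_capacity (codeword_seqs E) H"
    and \<pi>: "\<And>q. \<pi> $ q \<in> prob_simplex" "map_pmf g Px \<in> joint_dists E \<pi>"
    and f: "f \<in> F" "loss_integrable P L (\<lambda>a. f (g a))"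
  shows "\<exists>T'. (\<forall>a\<in>set_pmf Px. T' a = g a) \<and>
    (E, \<pi>, map_pmf g Px, f, T') \<in> feasible_B P Px L F H \<and>
    objective_B P L (E, \<pi>, map_pmf g Px, f, T') = expected_loss P L (\<lambda>a. f (g a))"
proof -
  have "g ` set_pmf Px \<subseteq> codeword_seqs E"
    using \<pi>(2) by (simp add: joint_dists_def)
  then obtain T' where T': "T' \<in> H" "range T' \<subseteq> codeword_seqs E" "\<And>a. a \<in> set_pmf Px \<Longrightarrow> T' a = g a"
    using H[unfolded infinite_capacity_def, rule_format, of "set_pmf Px" g] fin by auto
  have "map_pmf T' Px = map_pmf g Px"
    using T' by (intro map_pmf_cong) auto
  moreover have "expected_loss P L (\<lambda>a. f (T' a)) = expected_loss P L (\<lambda>a. f (g a))"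
    by (rule expected_loss_cong) (simp add: T' P)
  moreover have "loss_integrable P L (\<lambda>a. f (T' a)) = loss_integrable P L (\<lambda>a. f (g a))"
    by (rule loss_integrable_cong) (simp add: T' P)
  ultimately show ?thesis
    using \<pi> f T' by (intro exI[of _ T']) (auto simp: feasible_B_def)
qed

text \<open>The quantized encoder need not push the data to \<gamma>, so \<gamma> and \<pi> are
  replaced. This suffices to compare values but does not transfer minimizers.\<close>

lemma feasible_C_imp_feasible_B:
  fixes E :: "('d::finite, 'k::finite) codebook"
    and H :: "(real^'n::finite \<Rightarrow> ('d, 'q::finite) latent) set"
  assumes P: "map_pmf fst P = Px" and fin: "finite (set_pmf Px)"
    and H: "infinite_capacity (codeword_seqs E) H"
    and C: "(E, \<pi>, \<gamma>, f, T) \<in> feasible_C P L F G"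
  shows "\<exists>\<pi>' \<gamma>' T'. (E, \<pi>', \<gamma>', f, T') \<in> feasible_B P Px L F H \<and>
    objective_B P L (E, \<pi>', \<gamma>', f, T') = expected_loss P L (\<lambda>a. f (VQ E (T a)))"
proof -
  let ?g = "\<lambda>a. VQ E (T a)"
  have "set_pmf (map_pmf ?g Px) \<subseteq> codeword_seqs E"
    using VQ_in_codeword_seqs by auto
  then obtain \<pi>' where \<pi>': "\<And>q. \<pi>' $ q \<in> prob_simplex" "map_pmf ?g Px \<in> joint_dists E \<pi>'"
    using ex_weights_joint_dists by blast
  have "f \<in> F" "loss_integrable P L (\<lambda>a. f (?g a))"
    using C by (auto simp: feasible_C_def)
  then show ?thesis
    using ex_encoder_agreeing[OF P fin H \<pi>'] by blast
qed

section \<open>Equality of the optimal values and correspondence of the minimizers\<close>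

theorem theorem2:
  fixes N :: nat and x :: "nat \<Rightarrow> real^'n"
    and P :: "((real^'n) \<times> 'y) pmf"
    and L :: "'o \<Rightarrow> real^'n \<Rightarrow> 'y \<Rightarrow> real"
    and \<rho> :: "real^'d \<Rightarrow> real^'d \<Rightarrow> real"
    and lam :: real
    and F :: "(real^'d^'q \<Rightarrow> 'o) set"
    and H G :: "(real^'n \<Rightarrow> real^'d^'q) set"
  assumes N: "0 < N"
    and P: "map_pmf fst P = empirical N x"
    and rho: "Metric_space UNIV \<rho>"
    and lam: "0 < lam"
    and F: "infinite_capacity UNIV F"
    and H: "\<And>E :: real^'d^'k. infinite_capacity (codeword_seqs E) H"
    and G: "{T. continuous_on UNIV T} \<subseteq> G"
  defines "feasB \<equiv> (feasible_B P (empirical N x) L F H :: ('n, 'd, 'k, 'q, 'o) point set)"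
    and "objB \<equiv> objective_B P L"
    and "feasC \<equiv> (feasible_C P L F G :: ('n, 'd, 'k, 'q, 'o) point set)"
    and "objC \<equiv> objective_C P (empirical N x) L \<rho> lam"
  shows "optimal_value objB feasB = optimal_value objC feasC \<and>
    (\<forall>E \<pi> \<gamma> f T. minimizer objB feasB (E, \<pi>, \<gamma>, f, T) \<longrightarrow>
       (\<exists>T'. (\<forall>i<N. T' (x i) = T (x i)) \<and> minimizer objC feasC (E, \<pi>, \<gamma>, f, T'))) \<and>
    (\<forall>E \<pi> \<gamma> f T. minimizer objC feasC (E, \<pi>, \<gamma>, f, T) \<longrightarrow>
       (\<exists>T'. (\<forall>i<N. T' (x i) = T (x i)) \<and> minimizer objB feasB (E, \<pi>, \<gamma>, f, T')))"
proof -
  let ?Px = "empirical N x"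
  let ?W = "wasserstein (latent_dist \<rho>)"
  \<comment> \<open>Here \<open>0 < N\<close> is used: the support of \<open>pmf_of_set\<close> is
    known for nonempty finite sets.\<close>
  have set_Px: "set_pmf ?Px = x ` {..<N}"
    using N by (subst empirical_def, subst set_map_pmf, subst set_pmf_of_set) auto
  then have fin: "finite (set_pmf ?Px)" by simp
  have W_nonneg: "0 \<le> ?W \<mu> \<nu>" for \<mu> \<nu> :: "(real^'d^'q) pmf"
    by (rule wasserstein_nonneg) (rule latent_dist_nonneg[OF rho])
  have BC: "\<exists>T'. (\<forall>i<N. T' (x i) = T (x i)) \<and> (E, \<pi>, \<gamma>, f, T') \<in> feasC \<and>
      objC (E, \<pi>, \<gamma>, f, T') = objB (E, \<pi>, \<gamma>, f, T)"
    if "(E, \<pi>, \<gamma>, f, T) \<in> feasB" for E \<pi> \<gamma> f T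
    using feasible_B_imp_feasible_C[OF P fin rho G, of E \<pi> \<gamma> f T L F H lam] that set_Px
    unfolding feasB_def feasC_def objB_def objC_def by auto
  have CB: "\<exists>r\<in>feasB. objB r = expected_loss P L (\<lambda>a. f (VQ E (T a)))"
    if "(E, \<pi>, \<gamma>, f, T) \<in> feasC" for E \<pi> \<gamma> f T
    using feasible_C_imp_feasible_B[OF P fin H, of E \<pi> \<gamma> f T L F G] that
    unfolding feasB_def feasC_def objB_def by blast
  have BC': "\<exists>r\<in>feasC. objC r = objB p" if "p \<in> feasB" for p
    using BC that by (cases p) metis
  have CB': "\<exists>r\<in>feasB. objB r \<le> objC p" if p: "p \<in> feasC" for p
  proof -
    obtain E \<pi> \<gamma> f T where p_eq: "p = (E, \<pi>, \<gamma>, f, T)" by (cases p)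
    have "0 \<le> lam * ?W (map_pmf T ?Px) \<gamma>"
      using lam W_nonneg by simp
    moreover obtain r where "r \<in> feasB" "objB r = expected_loss P L (\<lambda>a. f (VQ E (T a)))"
      using CB p unfolding p_eq by blast
    ultimately show ?thesis
      by (intro bexI[of _ r]) (simp_all add: objC_def p_eq)
  qed
  have "optimal_value objB feasB = optimal_value objC feasC"
    unfolding optimal_value_def
  proof (rule antisym)
    show "(INF p\<in>feasB. ereal (objB p)) \<le> (INF p\<in>feasC. ereal (objC p))"
      by (rule INF_mono) (use CB' in auto)
    show "(INF p\<in>feasC. ereal (objC p)) \<le> (INF p\<in>feasB. ereal (objB p))"
      by (rule INF_mono) (metis BC' order_refl)
  qed
  moreover have "\<exists>T'. (\<forall>i<N. T' (x i) = T (x i)) \<and> minimizer objC feasC (E, \<pi>, \<gamma>, f, T')"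
    if "minimizer objB feasB (E, \<pi>, \<gamma>, f, T)" for E \<pi> \<gamma> f T
  proof -
    have B: "(E, \<pi>, \<gamma>, f, T) \<in> feasB" and min: "\<And>r. r \<in> feasB \<Longrightarrow> objB (E, \<pi>, \<gamma>, f, T) \<le> objB r"
      using that by (auto simp: minimizer_iff)
    have "objB (E, \<pi>, \<gamma>, f, T) \<le> objC r" if "r \<in> feasC" for r
      using CB'[OF that] min order_trans by blast
    then show ?thesis
      using BC[OF B] by (auto simp: minimizer_iff)
  qed
  moreover have "\<exists>T'. (\<forall>i<N. T' (x i) = T (x i)) \<and> minimizer objB feasB (E, \<pi>, \<gamma>, f, T')"
    if "minimizer objC feasC (E, \<pi>, \<gamma>, f, T)" for E \<pi> \<gamma> f T
  proof -
    have C: "(E, \<pi>, \<gamma>, f, T) \<in> feasC" and min: "\<And>r. r \<in> feasC \<Longrightarrow> objC (E, \<pi>, \<gamma>, f, T) \<le> objC r"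
      using that by (auto simp: minimizer_iff)
    let ?l = "expected_loss P L (\<lambda>a. f (VQ E (T a)))"
    have obj: "objC (E, \<pi>, \<gamma>, f, T) = ?l + lam * ?W (map_pmf T ?Px) \<gamma>"
      by (simp add: objC_def)
    have minB: "objC (E, \<pi>, \<gamma>, f, T) \<le> objB r" if "r \<in> feasB" for r
      using BC'[OF that] min by metis
    \<comment> \<open>The quantized encoder gives a point of (B) with value \<open>?l\<close>, and
      the minimum of (C) lies below every value of (B). Hence the penalty is at most 0, and
      \<open>lam\<close> being positive makes the distance vanish.\<close>
    have "objC (E, \<pi>, \<gamma>, f, T) \<le> ?l"
      using CB[OF C] minB by metis
    then have W: "?W (map_pmf T ?Px) \<gamma> = 0"
      using obj lam W_nonneg[of "map_pmf T ?Px" \<gamma>] by (simp add: mult_le_0_iff)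
    have \<gamma>: "\<gamma> \<in> joint_dists E \<pi>" and \<pi>: "\<And>q. \<pi> $ q \<in> prob_simplex" and f: "f \<in> F"
      and int: "loss_integrable P L (\<lambda>a. f (VQ E (T a)))"
      using C by (auto simp: feasC_def feasible_C_def)
    have sub: "set_pmf \<gamma> \<subseteq> codeword_seqs E"
      using \<gamma> by (simp add: joint_dists_def)
    have push: "map_pmf T ?Px = \<gamma>"
    proof (rule wasserstein_eq_0D[OF _ _ _ _ W])
      show "finite (set_pmf \<gamma>)"
        using sub finite_codeword_seqs finite_subset by blast
    qed (use fin latent_dist_nonneg[OF rho] latent_dist_eq_0_iff[OF rho] in auto)
    then have "T a \<in> codeword_seqs E" if "a \<in> set_pmf ?Px" for a
      using sub that by auto
    then have VQ_T: "f (VQ E (T a)) = f (T a)" if "a \<in> set_pmf (map_pmf fst P)" for a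
      using that P VQ_codeword_seq by metis
    have l: "?l = expected_loss P L (\<lambda>a. f (T a))"
      by (rule expected_loss_cong) (rule VQ_T)
    have int_T: "loss_integrable P L (\<lambda>a. f (T a))"
      by (rule iffD1[OF loss_integrable_cong int]) (rule VQ_T)
    \<comment> \<open>Now the interpolation can start from \<open>T\<close> instead of its
      quantization, so \<pi> and \<gamma> stay unchanged.\<close>
    have "map_pmf T ?Px \<in> joint_dists E \<pi>"
      using \<gamma> push by simp
    from ex_encoder_agreeing[OF P fin H \<pi> this f int_T]
    obtain T' where "\<forall>a\<in>set_pmf ?Px. T' a = T a" "(E, \<pi>, \<gamma>, f, T') \<in> feasB"
        "objB (E, \<pi>, \<gamma>, f, T') = ?l"
      unfolding push l feasB_def objB_def by blast
    then show ?thesis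
      using minB obj W set_Px by (intro exI[of _ T']) (auto simp: minimizer_iff)
  qed
  ultimately show ?thesis by blast
qed

end
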